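(* Let $\delta\ge1$ be an integer and $n\ge0$. For any vertex with degree $k$ in the graph $\mathcal{W}_n$, its clustering coefficient is $\frac{1}{k-1}$.
   Context: The clustering coefficient of a vertex $v$ of degree $k_v$ is $C_v=\frac{2\triangle_v}{k_v(k_v-1)}$, where $\triangle_v$ is the number of triangles containing $v$ (edge weights are ignored). The strength of a vertex $i$ in a weighted graph is $s_i=\sum_j w_{ij}$, the sum of the weights of its incident edges. The weighted graphs $\mathcal{W}_n$ ($n\ge 0$) are defined recursively for a fixed integer $\delta\ge1$. $\mathcal{W}_0$ is a triangle whose three edges have weight $1$. For $n\ge1$, $\mathcal{W}_n$ is obtained from $\mathcal{W}_{n-1}$ as follows: (I) for each vertex $i$ of $\mathcal{W}_{n-1}$, of strength $s_i$ in $\mathcal{W}_{n-1}$ (always an even integer), take $s_i/2$ new disjoint copies of $\mathcal{K}_2$ (two vertices joined by an edge of weight $1$) and join both vertices of each copy to $i$ by edges of weight $1$; (II) multiply the weight of every edge that already belonged to $\mathcal{W}_{n-1}$ by $1+\delta$. *)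

theory Defs
  imports Complex_Main
begin

text \<open>Edges are unordered pairs, i.e. two-element sets of vertices. All weights occurring in the
  construction are positive integers. The value of the weight function outside the edge set is
  irrelevant.\<close>

record 'a wgraph =
  verts :: "'a set"
  edges :: "'a set set"
  weight :: "'a set \<Rightarrow> nat"

definition degree :: "'a wgraph \<Rightarrow> 'a \<Rightarrow> nat" where
  "degree G v = card {e \<in> edges G. v \<in> e}"

definition strength :: "'a wgraph \<Rightarrow> 'a \<Rightarrow> nat" where
  "strength G v = (\<Sum>e | e \<in> edges G \<and> v \<in> e. weight G e)"

definition triangles_containing :: "'a wgraph \<Rightarrow> 'a \<Rightarrow> 'a set set" where
  "triangles_containing G v =
    {T. T \<subseteq> verts G \<and> card T = 3 \<and> v \<in> T \<and> (\<forall>x\<in>T. \<forall>y\<in>T. x \<noteq> y \<longrightarrow> {x, y} \<in> edges G)}"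

definition clustering_coefficient :: "'a wgraph \<Rightarrow> 'a \<Rightarrow> real" where
  "clustering_coefficient G v =
    2 * real (card (triangles_containing G v)) / (real (degree G v) * (real (degree G v) - 1))"

text \<open>\<^term>\<open>New n i c b\<close> is one of the two vertices (selected by \<open>b\<close>) of the copy with index \<open>c\<close>
  of the complete graph on two vertices that is attached to \<open>i\<close> when passing from stage \<open>n\<close> to
  stage \<open>n + 1\<close>. The tag \<open>n\<close> makes these vertices distinct from all vertices of stage \<open>n\<close>.\<close>

datatype vertex = Root nat | New nat vertex nat bool

definition initial_triangle :: "vertex wgraph" where
  "initial_triangle =
    \<lparr>verts = {Root 0, Root 1, Root 2},
     edges = {{Root 0, Root 1}, {Root 1, Root 2}, {Root 0, Root 2}},
     weight = (\<lambda>e. 1)\<rparr>"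

text \<open>The strengths in the graphs \<open>W \<delta> n\<close> below are even, so \<open>div 2\<close> is exact halving there.\<close>

definition grow :: "nat \<Rightarrow> nat \<Rightarrow> vertex wgraph \<Rightarrow> vertex wgraph" where
  "grow \<delta> n G =
    \<lparr>verts = verts G
       \<union> {New n i c b | i c b. i \<in> verts G \<and> c < strength G i div 2},
     edges = edges G
       \<union> {{New n i c False, New n i c True} | i c. i \<in> verts G \<and> c < strength G i div 2}
       \<union> {{i, New n i c b} | i c b. i \<in> verts G \<and> c < strength G i div 2},
     weight = (\<lambda>e. if e \<in> edges G then (1 + \<delta>) * weight G e else 1)\<rparr>"

primrec W :: "nat \<Rightarrow> nat \<Rightarrow> vertex wgraph" where
  "W \<delta> 0 = initial_triangle"
| "W \<delta> (Suc n) = grow \<delta> n (W \<delta> n)"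

end

theory Submission
  imports Defs
begin

text \<open>Every edge of \<open>W \<delta> n\<close> lies in exactly one triangle: this holds for the initial triangle, and a
  growth step glues new triangles to single old vertices, so an old edge acquires no new common
  neighbour of its endpoints. Counting pairs of an edge at \<open>v\<close> and a triangle containing that edge
  in two ways shows that the degree of \<open>v\<close> is twice the number of triangles at \<open>v\<close>.\<close>

section \<open>Graph properties preserved by the construction\<close>

definition simple_graph :: "'a wgraph \<Rightarrow> bool" where
  "simple_graph G \<longleftrightarrow> finite (verts G) \<and> (\<forall>e\<in>edges G. e \<subseteq> verts G \<and> card e = 2)"

text \<open>A triangle on an edge is encoded by its third vertex \<open>z\<close>. In a simple graph
  there are no loops, so \<open>z\<close> is automatically distinct from \<open>x\<close> and
  \<open>y\<close>.\<close>

definition edges_in_unique_triangle :: "'a wgraph \<Rightarrow> bool" where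
  "edges_in_unique_triangle G \<longleftrightarrow>
    (\<forall>x y. {x, y} \<in> edges G \<longrightarrow> (\<exists>!z. {x, z} \<in> edges G \<and> {y, z} \<in> edges G))"

definition no_isolated_vertex :: "'a wgraph \<Rightarrow> bool" where
  "no_isolated_vertex G \<longleftrightarrow> (\<forall>v\<in>verts G. \<exists>u. {v, u} \<in> edges G)"

lemma simple_graph_edgeD:
  assumes "simple_graph G" "{x, y} \<in> edges G"
  shows "x \<in> verts G" "y \<in> verts G" "x \<noteq> y"
  using assms by (auto simp: simple_graph_def)

lemma simple_graph_finite_edges:
  assumes "simple_graph G"
  shows "finite (edges G)"
proof (rule finite_subset)
  show "edges G \<subseteq> Pow (verts G)" using assms by (auto simp: simple_graph_def)
  show "finite (Pow (verts G))" using assms by (simp add: simple_graph_def)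
qed

lemma degree_pos:
  assumes "simple_graph G" "no_isolated_vertex G" "v \<in> verts G"
  shows "degree G v > 0"
proof -
  obtain u where "{v, u} \<in> edges G"
    using assms(2,3) by (auto simp: no_isolated_vertex_def)
  then have "{v, u} \<in> {e \<in> edges G. v \<in> e}" by simp
  moreover have "finite {e \<in> edges G. v \<in> e}"
    using simple_graph_finite_edges[OF assms(1)] by simp
  ultimately show ?thesis
    unfolding degree_def by (metis card_gt_0_iff empty_iff)
qed

section \<open>Double counting edges and triangles at a vertex\<close>

lemma triangle_containingE:
  assumes "T \<in> triangles_containing G v"
  obtains a b where "T = {v, a, b}" "a \<noteq> v" "b \<noteq> v" "a \<noteq> b"
    "{v, a} \<in> edges G" "{v, b} \<in> edges G" "{a, b} \<in> edges G"
proof -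
  have T: "card T = 3" "v \<in> T" "\<forall>x\<in>T. \<forall>y\<in>T. x \<noteq> y \<longrightarrow> {x, y} \<in> edges G"
    using assms by (auto simp: triangles_containing_def)
  then have "card (T - {v}) = 2" by simp
  then obtain a b where ab: "T - {v} = {a, b}" "a \<noteq> b" by (meson card_2_iff)
  then have "T = {v, a, b}" "a \<noteq> v" "b \<noteq> v" using T(2) by auto
  with ab(2) T(3) that show thesis by simp
qed

text \<open>First half of the double count: an edge at \<open>v\<close> inside
  \<open>{v, a, b}\<close> is fixed by its other end, \<open>a\<close> or \<open>b\<close>.\<close>

lemma card_edges_at_vertex_in_triangle:
  assumes "simple_graph G" "T \<in> triangles_containing G v"
  shows "card {e \<in> {e \<in> edges G. v \<in> e}. e \<subseteq> T} = 2"
proof -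
  obtain a b where T: "T = {v, a, b}" "a \<noteq> v" "b \<noteq> v" "a \<noteq> b"
    "{v, a} \<in> edges G" "{v, b} \<in> edges G"
    using assms(2) by (rule triangle_containingE)
  have "e = {v, a} \<or> e = {v, b}" if e: "e \<in> edges G" "v \<in> e" "e \<subseteq> T" for e
  proof -
    have "card e = 2" using assms(1) e(1) by (simp add: simple_graph_def)
    then obtain w where "e = {v, w}" "w \<noteq> v" using e(2) by (auto simp: card_2_iff)
    then show ?thesis using e(3) T(1) by auto
  qed
  then have "{e \<in> {e \<in> edges G. v \<in> e}. e \<subseteq> T} = {{v, a}, {v, b}}"
    using T by blast
  then show ?thesis using T(2-4) by (simp add: doubleton_eq_iff)
qed

text \<open>Second half of the double count: triangles on the edge \<open>{v, u}\<close> correspond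
  to common neighbours of \<open>v\<close> and \<open>u\<close>, of which there is just one.\<close>

lemma card_triangles_containing_edge:
  assumes G: "simple_graph G" "edges_in_unique_triangle G" and e: "e \<in> edges G" "v \<in> e"
  shows "card {T \<in> triangles_containing G v. e \<subseteq> T} = 1"
proof -
  have "card e = 2" using G(1) e(1) by (simp add: simple_graph_def)
  then obtain u where u: "e = {v, u}" "u \<noteq> v" using e(2) by (auto simp: card_2_iff)
  then obtain z where z: "{v, z} \<in> edges G" "{u, z} \<in> edges G"
    and uniq: "\<And>z'. {v, z'} \<in> edges G \<Longrightarrow> {u, z'} \<in> edges G \<Longrightarrow> z' = z"
    using G(2) e(1) unfolding edges_in_unique_triangle_def by blast
  have "{v, u, z} \<in> triangles_containing G v"
    using simple_graph_edgeD[OF G(1)] z e(1) u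
    by (auto simp: triangles_containing_def insert_commute)
  moreover have "T = {v, u, z}" if T: "T \<in> triangles_containing G v" "e \<subseteq> T" for T
  proof -
    obtain a b where ab: "T = {v, a, b}" "{v, a} \<in> edges G" "{v, b} \<in> edges G" "{a, b} \<in> edges G"
      using T(1) by (rule triangle_containingE)
    \<comment> \<open>Whichever of \<open>a\<close> and \<open>b\<close> is not \<open>u\<close> is
      a common neighbour of \<open>v\<close> and \<open>u\<close>, hence equals
      \<open>z\<close>.\<close>
    then have "u = a \<or> u = b" using T(2) u by auto
    then show ?thesis
      using ab uniq[of a] uniq[of b] by (auto simp: insert_commute)
  qed
  ultimately have "{T \<in> triangles_containing G v. e \<subseteq> T} = {{v, u, z}}"
    using u(1) by blast
  then show ?thesis by simp
qed

lemma degree_eq_twice_card_triangles: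
  assumes "simple_graph G" "edges_in_unique_triangle G"
  shows "degree G v = 2 * card (triangles_containing G v)"
proof -
  have "triangles_containing G v \<subseteq> Pow (verts G)"
    by (auto simp: triangles_containing_def)
  moreover have "finite (verts G)" using assms(1) by (simp add: simple_graph_def)
  ultimately have "finite (triangles_containing G v)" by (simp add: finite_subset)
  moreover have "finite {e \<in> edges G. v \<in> e}"
    using simple_graph_finite_edges[OF assms(1)] by simp
  \<comment> \<open>Incidence is \<open>e \<subseteq> T\<close>. Summed by edges, each term is 1,
    which gives the degree; the terms on the left are all 2.\<close>
  ultimately have
    "(\<Sum>T\<in>triangles_containing G v. card {e \<in> {e \<in> edges G. v \<in> e}. e \<subseteq> T})
      = (\<Sum>e | e \<in> edges G \<and> v \<in> e. 1)"
    by (intro sum_multicount_gen) (auto simp: card_triangles_containing_edge[OF assms, simplified])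
  then show ?thesis
    by (simp add: degree_def card_edges_at_vertex_in_triangle[OF assms(1), simplified])
qed

section \<open>Adjacency after one growth step\<close>

text \<open>Each attached copy forms a triangle with apex \<open>i\<close>: \<open>tip\<close> edges
  meet the apex, and the \<open>base\<close> edge is the copy itself.\<close>

lemma edge_grow_cases [consumes 1, case_names old tip base]:
  assumes "e \<in> edges (grow \<delta> n G)"
  obtains "e \<in> edges G"
  | i c b where "e = {i, New n i c b}" "i \<in> verts G" "c < strength G i div 2"
  | i c where "e = {New n i c False, New n i c True}" "i \<in> verts G" "c < strength G i div 2"
  using assms by (auto simp: grow_def)

lemma tip_edge_in_grow:
  assumes "i \<in> verts G" "c < strength G i div 2"
  shows "{i, New n i c b} \<in> edges (grow \<delta> n G)"
proof -
  have "{i, New n i c b} \<in> {{i, New n i c b} | i c b. i \<in> verts G \<and> c < strength G i div 2}"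
    using assms by blast
  then show ?thesis by (simp add: grow_def)
qed

text \<open>Stated symmetrically in \<open>b\<close>, so that the partner of
  \<open>New n i c b\<close> is always \<open>New n i c (\<not> b)\<close>.\<close>

lemma base_edge_in_grow:
  assumes "i \<in> verts G" "c < strength G i div 2"
  shows "{New n i c b, New n i c (\<not> b)} \<in> edges (grow \<delta> n G)"
proof -
  have "{New n i c False, New n i c True} \<in> edges (grow \<delta> n G)"
    using assms by (auto simp: grow_def)
  then show ?thesis by (cases b) (simp_all add: insert_commute)
qed

lemma simple_graph_grow:
  assumes G: "simple_graph G" and fresh: "\<And>i c b. New n i c b \<notin> verts G"
  shows "simple_graph (grow \<delta> n G)"
proof -
  \<comment> \<open>As a union over finite index sets, the set of new vertices is visibly
    finite.\<close>
  have "{New n i c b | i c b. i \<in> verts G \<and> c < strength G i div 2}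
      = (\<Union>i\<in>verts G. \<Union>c<strength G i div 2. \<Union>b. {New n i c b})" by auto
  moreover have "finite \<dots>" using G by (auto simp: simple_graph_def)
  ultimately have "finite (verts (grow \<delta> n G))" using G by (simp add: grow_def simple_graph_def)
  moreover have "e \<subseteq> verts (grow \<delta> n G) \<and> card e = 2" if "e \<in> edges (grow \<delta> n G)" for e
    using that
  proof (cases rule: edge_grow_cases)
    case old
    then show ?thesis using G by (auto simp: simple_graph_def grow_def)
  next
    case (tip i c b)
    then have "i \<noteq> New n i c b" using fresh by metis
    with tip show ?thesis by (auto simp: grow_def)
  next
    case base
    then show ?thesis by (auto simp: grow_def)
  qed
  ultimately show ?thesis by (simp add: simple_graph_def)
qed

lemma no_isolated_vertex_grow:
  assumes "no_isolated_vertex G"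
  shows "no_isolated_vertex (grow \<delta> n G)"
  unfolding no_isolated_vertex_def
proof
  fix v assume "v \<in> verts (grow \<delta> n G)"
  then consider "v \<in> verts G"
    | i c b where "v = New n i c b" "i \<in> verts G" "c < strength G i div 2"
    by (auto simp: grow_def)
  then show "\<exists>u. {v, u} \<in> edges (grow \<delta> n G)"
  proof cases
    case 1
    then show ?thesis using assms by (auto simp: no_isolated_vertex_def grow_def)
  next
    case (2 i c b)
    then have "{v, i} \<in> edges (grow \<delta> n G)"
      using tip_edge_in_grow by (simp add: insert_commute)
    then show ?thesis ..
  qed
qed

text \<open>Every added edge has a new endpoint, and by freshness that endpoint is not an old
  vertex.\<close>

lemma edge_grow_old_iff:
  assumes "\<And>i c b. New n i c b \<notin> verts G" "x \<in> verts G" "y \<in> verts G"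
  shows "{x, y} \<in> edges (grow \<delta> n G) \<longleftrightarrow> {x, y} \<in> edges G"
  using assms by (auto simp: grow_def doubleton_eq_iff)

text \<open>No old edge reaches a fresh vertex, and the arguments of \<open>New\<close> record the
  apex and the copy, so they determine both neighbours.\<close>

lemma edge_grow_new_iff:
  assumes G: "simple_graph G" and fresh: "\<And>i c b. New n i c b \<notin> verts G"
  shows "{New n i c b, y} \<in> edges (grow \<delta> n G) \<longleftrightarrow>
    i \<in> verts G \<and> c < strength G i div 2 \<and> (y = i \<or> y = New n i c (\<not> b))"
proof -
  have old: "{New n i c b, y} \<notin> edges G"
    using simple_graph_edgeD(1)[OF G] fresh by blast
  show ?thesis
  proof
    assume "{New n i c b, y} \<in> edges (grow \<delta> n G)"
    then show "i \<in> verts G \<and> c < strength G i div 2 \<and> (y = i \<or> y = New n i c (\<not> b))"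
      by (cases rule: edge_grow_cases) (use old fresh in \<open>auto simp: doubleton_eq_iff\<close>)
  next
    assume "i \<in> verts G \<and> c < strength G i div 2 \<and> (y = i \<or> y = New n i c (\<not> b))"
    then show "{New n i c b, y} \<in> edges (grow \<delta> n G)"
      using tip_edge_in_grow[of i G c n b \<delta>] base_edge_in_grow[of i G c n b \<delta>]
      by (auto simp: insert_commute)
  qed
qed

lemma edges_in_unique_triangle_grow:
  assumes G: "simple_graph G" "edges_in_unique_triangle G"
    and fresh: "\<And>i c b. New n i c b \<notin> verts G"
  shows "edges_in_unique_triangle (grow \<delta> n G)"
  unfolding edges_in_unique_triangle_def
proof (intro allI impI)
  fix x y
  let ?E = "edges (grow \<delta> n G)"
  note new_iff = edge_grow_new_iff[OF G(1) fresh]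
  assume xy: "{x, y} \<in> ?E"
  have edge_verts: "u \<in> verts G \<or> (\<exists>i c b. u = New n i c b)" if "{u, w} \<in> ?E" for u w
    using simple_graph_edgeD(1)[OF simple_graph_grow[OF G(1) fresh] that]
    by (auto simp: grow_def)
  \<comment> \<open>Edges with a new endpoint \<open>u\<close>: the other end is the apex or the
    partner of \<open>u\<close>, and the remaining one of these two is the third vertex. Keeping
    \<open>u\<close> and \<open>w\<close> general covers both orientations of
    \<open>{x, y}\<close>.\<close>
  have new_case: "\<exists>!z. {u, z} \<in> ?E \<and> {w, z} \<in> ?E"
    if u: "u = New n i c b" and uw: "{u, w} \<in> ?E" for u w i c b
  proof -
    from uw u have i: "i \<in> verts G" "c < strength G i div 2"
      and w: "w = i \<or> w = New n i c (\<not> b)" by (auto simp: new_iff)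
    \<comment> \<open>When \<open>w\<close> is the apex, this excludes the apex itself as a common
      neighbour.\<close>
    have loop: "{i, i} \<notin> ?E"
      using simple_graph_edgeD(3)[OF simple_graph_grow[OF G(1) fresh]] by blast
    have tip: "{i, New n i c b'} \<in> ?E" for b'
      using i by (rule tip_edge_in_grow)
    from w show ?thesis
    proof
      assume "w = i"
      then show ?thesis using u i loop tip by (auto simp: new_iff)
    next
      assume "w = New n i c (\<not> b)"
      then show ?thesis using u i by (auto simp: new_iff)
    qed
  qed
  show "\<exists>!z. {x, z} \<in> ?E \<and> {y, z} \<in> ?E"
  proof (cases "x \<in> verts G \<and> y \<in> verts G")
    case True
    then have "{x, y} \<in> edges G" using xy by (simp add: edge_grow_old_iff fresh)
    then have "x \<noteq> y" and ex1: "\<exists>!z. {x, z} \<in> edges G \<and> {y, z} \<in> edges G"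
      using G simple_graph_edgeD(3) by (fastforce simp: edges_in_unique_triangle_def)+
    \<comment> \<open>Two old vertices keep exactly their old common neighbours: the only old
      neighbour of a new vertex is its apex, which cannot be both \<open>x\<close> and
      \<open>y\<close>.\<close>
    have "{x, z} \<in> ?E \<and> {y, z} \<in> ?E \<longleftrightarrow> {x, z} \<in> edges G \<and> {y, z} \<in> edges G" for z
    proof (cases "z \<in> verts G")
      case True
      with \<open>x \<in> verts G \<and> y \<in> verts G\<close> show ?thesis by (simp add: edge_grow_old_iff fresh)
    next
      case False
      have "\<not> ({x, z} \<in> ?E \<and> {y, z} \<in> ?E)"
      proof
        assume z: "{x, z} \<in> ?E \<and> {y, z} \<in> ?E"
        then obtain i c b where "z = New n i c b"
          using edge_verts[of z x] False by (auto simp: insert_commute)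
        with z have "x = i" "y = i"
          using True fresh new_iff[of i c b x] new_iff[of i c b y]
          by (auto simp: insert_commute)
        with \<open>x \<noteq> y\<close> show False by simp
      qed
      moreover have "{x, z} \<notin> edges G" using False simple_graph_edgeD(2)[OF G(1)] by blast
      ultimately show ?thesis by blast
    qed
    with ex1 show ?thesis by simp
  next
    case False
    have yx: "{y, x} \<in> ?E" using xy by (simp add: insert_commute)
    from False edge_verts[OF xy] edge_verts[OF yx]
    consider i c b where "x = New n i c b" | i c b where "y = New n i c b" by blast
    then show ?thesis
    proof cases
      case 1
      then show ?thesis using new_case xy by blast
    next
      case 2
      then show ?thesis using new_case[OF _ yx] by (simp add: conj_commute)
    qed
  qed
qed

section \<open>Invariants of the graphs \<open>W \<delta> n\<close>\<close>

lemma New_in_verts_W_imp_less: "New m i c b \<in> verts (W \<delta> n) \<Longrightarrow> m < n"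
  by (induction n) (auto simp: initial_triangle_def grow_def less_Suc_eq)

text \<open>The invariants go through one joint induction because preserving unique triangles relies
  on simplicity at the same stage.\<close>

lemma W_invariants:
  "simple_graph (W \<delta> n) \<and> edges_in_unique_triangle (W \<delta> n) \<and> no_isolated_vertex (W \<delta> n)"
proof (induction n)
  case 0
  \<comment> \<open>The initial graph is complete on the three roots, so the third vertex on an edge
    is whatever root remains after removing both endpoints.\<close>
  have adj: "{x, y} \<in> edges initial_triangle \<longleftrightarrow>
      x \<noteq> y \<and> x \<in> {Root 0, Root 1, Root 2} \<and> y \<in> {Root 0, Root 1, Root 2}" for x y
    by (auto simp: initial_triangle_def doubleton_eq_iff)
  have "simple_graph initial_triangle"
    by (auto simp: simple_graph_def initial_triangle_def)
  moreover have "edges_in_unique_triangle initial_triangle"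
    unfolding edges_in_unique_triangle_def
  proof (intro allI impI)
    fix x y assume xy: "{x, y} \<in> edges initial_triangle"
    then have "card ({Root 0, Root 1, Root 2} - {x, y}) = 1"
      unfolding adj by (subst card_Diff_subset) auto
    then obtain z where "{Root 0, Root 1, Root 2} - {x, y} = {z}"
      by (rule card_1_singletonE)
    then have "w \<in> {Root 0, Root 1, Root 2} \<and> w \<noteq> x \<and> w \<noteq> y \<longleftrightarrow> w = z" for w
      by blast
    then have "{x, w} \<in> edges initial_triangle \<and> {y, w} \<in> edges initial_triangle \<longleftrightarrow> w = z" for w
      using xy unfolding adj by metis
    then show "\<exists>!z. {x, z} \<in> edges initial_triangle \<and> {y, z} \<in> edges initial_triangle"
      by simp
  qed
  moreover have "no_isolated_vertex initial_triangle"
  proof -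
    have "{v, if v = Root 0 then Root 1 else Root 0} \<in> edges initial_triangle"
      if "v \<in> verts initial_triangle" for v
      using that unfolding adj by (auto simp: initial_triangle_def)
    then show ?thesis
      unfolding no_isolated_vertex_def by blast
  qed
  ultimately show ?case by simp
next
  case (Suc n)
  have "New n i c b \<notin> verts (W \<delta> n)" for i c b
    using New_in_verts_W_imp_less by blast
  with Suc show ?case
    by (simp add: simple_graph_grow edges_in_unique_triangle_grow no_isolated_vertex_grow)
qed

theorem proposition3p4:
  fixes \<delta> n k :: nat and v :: vertex
  assumes "\<delta> \<ge> 1"
    and "v \<in> verts (W \<delta> n)"
    and "degree (W \<delta> n) v = k"
  shows "clustering_coefficient (W \<delta> n) v = 1 / (real k - 1)"
proof -
  \<comment> \<open>Positivity permits cancelling \<open>k\<close>. At \<open>k = 0\<close>,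
    division by zero would make the left side 0 and the right side -1.\<close>
  have "k > 0"
    using degree_pos[of "W \<delta> n" v] W_invariants[of \<delta> n] assms(2,3) by simp
  moreover have "2 * real (card (triangles_containing (W \<delta> n) v)) = real k"
    using degree_eq_twice_card_triangles[of "W \<delta> n" v] W_invariants[of \<delta> n] assms(3) by simp
  ultimately show ?thesis
    by (simp add: clustering_coefficient_def assms(3))
qed

end
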